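(* Define $S:C[0,1]\to C[0,1]$ by $S(f)=\sin(f)$ (i.e. $S(f)(t)=\sin(f(t))$) for $f\in C[0,1]$. Then $S$ is Fréchet differentiable on $C[0,1]$, and for every $\bar f\in C[0,1]$ the Fréchet derivative $\nabla S(\bar f):C[0,1]\to C[0,1]$ satisfies $$\nabla S(\bar f)(g)=\cos(\bar f)\,g\quad\text{for every } g\in C[0,1].$$ Therefore $S$ is Gâteaux differentiable on $C[0,1]$ and the Gâteaux derivative satisfies $$S'(\bar f)(g)=\nabla S(\bar f)(g)=\cos(\bar f)\,g\quad\text{for every } g\in C[0,1].$$
   Context: $C[0,1]$ is the Banach space of real continuous functions on $[0,1]$ with norm $\|f\|_C=\max\{|f(x)|:x\in[0,1]\}$ and origin $\theta_C$. A map $T:C[0,1]\to C[0,1]$ is Fréchet differentiable at $\bar f$ with derivative $\nabla T(\bar f)$ if $\nabla T(\bar f)$ is a continuous linear operator and $\lim_{u\to\theta_C}\frac{T(\bar f+u)-T(\bar f)-\nabla T(\bar f)(u)}{\|u\|_C}=\theta_C$. $T$ is Gâteaux differentiable at $\bar f$ if for every $g\neq\theta_C$ the norm limit $T'(\bar f)(g)=\lim_{t\to0}\frac{T(\bar f+tg)-T(\bar f)}{t}$ ($t$ real) exists; for $g=\theta_C$ the same limit is trivially $\theta_C$ and the same notation is used. *)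

theory Defs
  imports "HOL-Analysis.Analysis"
begin

text \<open>
  The library's space of bounded continuous functions carries the supremum norm, but its domain
  is a whole type. The interval [0,1] with the metric of the real line is therefore turned into a
  type.
\<close>

typedef unit_interval = "{0..1::real}"
  morphisms real_of_unit unit_of_real
  by auto

instantiation unit_interval :: metric_space
begin

definition dist_unit_interval :: "unit_interval \<Rightarrow> unit_interval \<Rightarrow> real"
  where "dist_unit_interval x y = dist (real_of_unit x) (real_of_unit y)"

definition uniformity_unit_interval :: "(unit_interval \<times> unit_interval) filter"
  where "uniformity_unit_interval = (INF e\<in>{0 <..}. principal {(x, y). dist x y < e})"

definition open_unit_interval :: "unit_interval set \<Rightarrow> bool"
  where "open_unit_interval U = (\<forall>x\<in>U. \<forall>\<^sub>F (x', y) in uniformity. x' = x \<longrightarrow> y \<in> U)"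

instance
proof
  fix x y z :: unit_interval
  show "dist x y = 0 \<longleftrightarrow> x = y"
    by (simp add: dist_unit_interval_def real_of_unit_inject)
  show "dist x y \<le> dist x z + dist y z"
    by (simp add: dist_unit_interval_def dist_triangle2)
qed (rule open_unit_interval_def uniformity_unit_interval_def)+

end

type_synonym C01 = "unit_interval \<Rightarrow>\<^sub>C real"

lemma continuous_on_real_of_unit: "continuous_on A real_of_unit"
  by (auto simp: continuous_on_iff dist_unit_interval_def)

lemma continuous_on_unit_of_real: "continuous_on {0..1} unit_of_real"
  by (auto simp: continuous_on_iff dist_unit_interval_def unit_of_real_inverse)

lemma range_unit_of_real: "unit_of_real ` {0..1} = UNIV"
  using type_definition.Abs_image[OF type_definition_unit_interval] .

lemma compact_UNIV_unit_interval: "compact (UNIV :: unit_interval set)"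
  using compact_continuous_image[OF continuous_on_unit_of_real] range_unit_of_real by simp

lemma continuous_imp_bcontfun:
  fixes h :: "unit_interval \<Rightarrow> real"
  assumes "continuous_on UNIV h"
  shows "h \<in> bcontfun"
  using compact_imp_bounded[OF compact_continuous_image[OF assms compact_UNIV_unit_interval]] assms
  by (simp add: bcontfun_def)

text \<open>
  Every continuous function on the interval is bounded, so \<^typ>\<open>C01\<close> consists of exactly the
  continuous functions on it, and the supremum norm is the maximum norm.
\<close>

lemma continuous_on_C01:
  fixes f :: C01
  shows "continuous_on {0..1} (\<lambda>x. f (unit_of_real x))"
  by (rule continuous_on_compose2[OF continuous_on_apply_bcontfun continuous_on_unit_of_real subset_UNIV])

lemma ex_C01:
  assumes "continuous_on {0..1} h"
  shows "\<exists>f :: C01. \<forall>x\<in>{0..1}. f (unit_of_real x) = h x"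
proof -
  have "continuous_on UNIV (\<lambda>x. h (real_of_unit x))"
    by (rule continuous_on_compose2[OF assms continuous_on_real_of_unit]) (use real_of_unit in auto)
  then have "(\<lambda>x. h (real_of_unit x)) \<in> bcontfun"
    by (rule continuous_imp_bcontfun)
  then show ?thesis
    by (intro exI[of _ "Bcontfun (\<lambda>x. h (real_of_unit x))"])
      (simp add: Bcontfun_inverse unit_of_real_inverse)
qed

lemma norm_C01_max:
  fixes f :: C01
  shows "\<exists>x. norm f = \<bar>f x\<bar>" and "\<bar>f y\<bar> \<le> norm f"
proof -
  have "continuous_on UNIV (\<lambda>x. \<bar>f x\<bar>)"
    by (intro continuous_intros continuous_on_apply_bcontfun)
  then obtain x where x: "\<And>y. \<bar>f y\<bar> \<le> \<bar>f x\<bar>"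
    using continuous_attains_sup[OF compact_UNIV_unit_interval] by blast
  have "norm f \<le> \<bar>f x\<bar>"
    by (rule norm_bound) (simp add: x)
  moreover show le: "\<bar>f y\<bar> \<le> norm f" for y
    using norm_bounded[of f y] by simp
  ultimately show "\<exists>x. norm f = \<bar>f x\<bar>"
    by (intro exI[of _ x] antisym)
qed

definition sin_C :: "C01 \<Rightarrow> C01"
  where "sin_C f = Bcontfun (\<lambda>t. sin (f t))"

definition cos_C :: "C01 \<Rightarrow> C01"
  where "cos_C f = Bcontfun (\<lambda>t. cos (f t))"

definition mult_C :: "C01 \<Rightarrow> C01 \<Rightarrow> C01"  (infixl \<open>\<cdot>\<^sub>C\<close> 70)
  where "f \<cdot>\<^sub>C g = Bcontfun (\<lambda>t. f t * g t)"

text \<open>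
  The abstraction function \<^const>\<open>Bcontfun\<close> is only ever applied to functions in
  \<^const>\<open>bcontfun\<close> here, so the three operations are the pointwise ones.
\<close>

lemma apply_sin_C [simp]: "sin_C f t = sin (f t)"
  unfolding sin_C_def
  by (subst Bcontfun_inverse) (auto intro!: continuous_imp_bcontfun continuous_intros)

lemma apply_cos_C [simp]: "cos_C f t = cos (f t)"
  unfolding cos_C_def
  by (subst Bcontfun_inverse) (auto intro!: continuous_imp_bcontfun continuous_intros)

lemma apply_mult_C [simp]: "(f \<cdot>\<^sub>C g) t = f t * g t"
  unfolding mult_C_def
  by (subst Bcontfun_inverse) (auto intro!: continuous_imp_bcontfun continuous_intros)

definition gateaux_differentiable_at ::
    "('a::real_normed_vector \<Rightarrow> 'b::real_normed_vector) \<Rightarrow> 'a \<Rightarrow> bool"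
  where "gateaux_differentiable_at T f \<longleftrightarrow>
    (\<forall>g. g \<noteq> 0 \<longrightarrow> (\<exists>L. ((\<lambda>t::real. (T (f + t *\<^sub>R g) - T f) /\<^sub>R t) \<longlongrightarrow> L) (at 0)))"

text \<open>
  As usual for \<^const>\<open>Lim\<close>, the value is meaningful only where the limit exists. For
  \<^prop>\<open>g = 0\<close> the limit always exists and is 0.
\<close>

definition gateaux_derivative ::
    "('a::real_normed_vector \<Rightarrow> 'b::real_normed_vector) \<Rightarrow> 'a \<Rightarrow> 'a \<Rightarrow> 'b"
  where "gateaux_derivative T f g = Lim (at 0) (\<lambda>t::real. (T (f + t *\<^sub>R g) - T f) /\<^sub>R t)"

end

theory Submission
  imports Defs
begin

text \<open>
  The pointwise estimate \<open>\<bar>sin (a + u) - sin a - u cos a\<bar> \<le> u\<^sup>2\<close> is uniform in \<open>a\<close>, so it passes to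
  the supremum norm and bounds the remainder of the linearization by the square of the norm of the
  increment. The Gateaux derivative is the derivative of the restriction to a line.
\<close>

lemma abs_sin_add_remainder_le:
  fixes a u :: real
  shows "\<bar>sin (a + u) - sin a - cos a * u\<bar> \<le> u\<^sup>2"
proof -
  have s: "\<bar>sin u - u\<bar> \<le> u\<^sup>2 / 2"
    \<comment> \<open>With two Taylor terms the polynomial is just \<open>u\<close>, and the
      remainder bound carries the factor 1/2!.\<close>
    using Maclaurin_sin_bound[of u 2] by (simp add: numeral_2_eq_2 sin_coeff_def)
  \<comment> \<open>This serves the half-angle identity
    \<open>1 - cos u = 2 * (sin (u / 2))\<^sup>2\<close>.\<close>
  have "\<bar>sin (u / 2)\<bar>\<^sup>2 \<le> \<bar>u / 2\<bar>\<^sup>2"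
    by (intro power_mono abs_sin_x_le_abs_x abs_ge_zero)
  then have c: "\<bar>cos u - 1\<bar> \<le> u\<^sup>2 / 2"
    using cos_double_sin[of "u / 2"] by (simp add: power_divide)
  have "sin (a + u) - sin a - cos a * u = sin a * (cos u - 1) + cos a * (sin u - u)"
    by (simp add: sin_add algebra_simps)
  also have "\<bar>\<dots>\<bar> \<le> \<bar>sin a\<bar> * \<bar>cos u - 1\<bar> + \<bar>cos a\<bar> * \<bar>sin u - u\<bar>"
    by (metis abs_mult abs_triangle_ineq)
  also have "\<dots> \<le> 1 * (u\<^sup>2 / 2) + 1 * (u\<^sup>2 / 2)"
    by (intro add_mono mult_mono s c) auto
  finally show ?thesis by simp
qed

text \<open>Makes the candidate derivative admissible; \<open>norm f\<close> bounds its operator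
  norm.\<close>

lemma bounded_linear_mult_C: "bounded_linear (\<lambda>g. f \<cdot>\<^sub>C g)"
proof (rule bounded_linear_intro)
  show "norm (f \<cdot>\<^sub>C g) \<le> norm g * norm f" for g
  proof (rule norm_bound)
    show "norm ((f \<cdot>\<^sub>C g) t) \<le> norm g * norm f" for t
      using mult_mono[OF norm_C01_max(2)[of g t] norm_C01_max(2)[of f t]]
      by (simp add: abs_mult mult.commute)
  qed
qed (auto intro!: bcontfun_eqI simp: algebra_simps)

lemma has_derivative_sin_C: "(sin_C has_derivative (\<lambda>g. cos_C f \<cdot>\<^sub>C g)) (at f)"
\<comment> \<open>The radius 1 is arbitrary, since the quadratic bound holds for all
  \<open>h\<close>; dividing it by \<open>norm (h - f)\<close> leaves \<open>H\<close>.\<close>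
proof (rule has_derivativeI_sandwich[where e = 1 and H = "\<lambda>h. norm (h - f)"])
  show "((\<lambda>h. norm (h - f)) \<longlongrightarrow> 0) (at f)"
    by (auto intro!: tendsto_eq_intros)
next
  fix h :: C01
  assume "h \<noteq> f"
  have "norm (sin_C h - sin_C f - cos_C f \<cdot>\<^sub>C (h - f)) \<le> (norm (h - f))\<^sup>2"
  proof (rule norm_bound)
    fix t
    have "\<bar>(sin_C h - sin_C f - cos_C f \<cdot>\<^sub>C (h - f)) t\<bar> \<le> \<bar>(h - f) t\<bar>\<^sup>2"
      using abs_sin_add_remainder_le[of "f t" "h t - f t"] by simp
    also have "\<dots> \<le> (norm (h - f))\<^sup>2"
      by (intro power_mono norm_C01_max(2) abs_ge_zero)
    finally show "norm ((sin_C h - sin_C f - cos_C f \<cdot>\<^sub>C (h - f)) t) \<le> (norm (h - f))\<^sup>2"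
      by simp
  qed
  with \<open>h \<noteq> f\<close> show "norm (sin_C h - sin_C f - cos_C f \<cdot>\<^sub>C (h - f)) / norm (h - f) \<le> norm (h - f)"
    by (simp add: divide_le_eq power2_eq_square)
qed (simp_all add: bounded_linear_mult_C)

lemma has_derivative_imp_directional_limit:
  assumes "(T has_derivative T') (at f)"
  shows "((\<lambda>t::real. (T (f + t *\<^sub>R g) - T f) /\<^sub>R t) \<longlongrightarrow> T' g) (at 0)"
proof -
  have "((\<lambda>t. f + t *\<^sub>R g) has_derivative (\<lambda>t. t *\<^sub>R g)) (at (0::real))"
    by (auto intro!: derivative_eq_intros)
  then have "((\<lambda>t. T (f + t *\<^sub>R g)) has_derivative (\<lambda>t. T' (t *\<^sub>R g))) (at (0::real))"
    by (rule has_derivative_compose) (simp add: assms)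
  then have "((\<lambda>t. norm (T (f + t *\<^sub>R g) - T f - T' (t *\<^sub>R g)) / norm t) \<longlongrightarrow> 0) (at (0::real))"
    by (simp only: has_derivative_at scaleR_zero_left add_0_left add_0_right)
  \<comment> \<open>Linearity of \<open>T'\<close> cancels the factor \<open>t\<close>, turning the
    remainder quotient from the chain rule into the distance to the claimed limit.\<close>
  moreover have "norm (T (f + t *\<^sub>R g) - T f - T' (t *\<^sub>R g)) / norm t =
      norm ((T (f + t *\<^sub>R g) - T f) /\<^sub>R t - T' g)" if "t \<noteq> 0" for t :: real
  proof -
    have "(T (f + t *\<^sub>R g) - T f) /\<^sub>R t - T' g = (T (f + t *\<^sub>R g) - T f - T' (t *\<^sub>R g)) /\<^sub>R t"
      using that linear_scale[OF has_derivative_linear[OF assms]]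
      by (simp add: scaleR_right_diff_distrib)
    then show ?thesis by (simp only: norm_scaleR norm_inverse real_norm_def abs_inverse divide_inverse mult.commute)
  qed
  ultimately have "((\<lambda>t. norm ((T (f + t *\<^sub>R g) - T f) /\<^sub>R t - T' g)) \<longlongrightarrow> 0) (at (0::real))"
    \<comment> \<open>The two expressions may differ at \<open>t = 0\<close>, a point that the
      filter \<open>at 0\<close> ignores.\<close>
    by (elim Lim_transform_eventually) (auto simp: eventually_at_filter)
  then show ?thesis
    by (simp only: tendsto_norm_zero_iff LIM_zero_iff)
qed

lemma gateaux_differentiable_at_if_differentiable:
  "T differentiable (at f) \<Longrightarrow> gateaux_differentiable_at T f"
  unfolding gateaux_differentiable_at_def differentiable_def
  using has_derivative_imp_directional_limit by blast

text \<open>Limits at 0 on the real line are unique, so \<open>Lim\<close> returns the directional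
  limit; \<open>g = 0\<close> is covered without a separate case.\<close>

lemma gateaux_derivative_eq:
  "(T has_derivative T') (at f) \<Longrightarrow> gateaux_derivative T f g = T' g"
  unfolding gateaux_derivative_def
  by (rule tendsto_Lim[OF _ has_derivative_imp_directional_limit]) simp

theorem theorem4p3:
  shows "(\<forall>f :: C01. sin_C differentiable (at f)) \<and>
    (\<forall>f g :: C01. frechet_derivative sin_C (at f) g = cos_C f \<cdot>\<^sub>C g) \<and>
    (\<forall>f :: C01. gateaux_differentiable_at sin_C f) \<and>
    (\<forall>f g :: C01. gateaux_derivative sin_C f g = frechet_derivative sin_C (at f) g \<and>
      frechet_derivative sin_C (at f) g = cos_C f \<cdot>\<^sub>C g)"
proof -
  have diff: "sin_C differentiable (at f)" for f
    using has_derivative_sin_C by (rule differentiableI)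
  have frechet: "frechet_derivative sin_C (at f) = (\<lambda>g. cos_C f \<cdot>\<^sub>C g)" for f
    \<comment> \<open>\<open>frechet_derivative\<close> is a choice among derivatives; uniqueness at
      a point identifies it.\<close>
    using frechet_derivative_at[OF has_derivative_sin_C] by simp
  show ?thesis
    by (simp add: diff frechet gateaux_differentiable_at_if_differentiable
        gateaux_derivative_eq[OF has_derivative_sin_C])
qed

end
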